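(* Let $\Omega\subseteq\mathbb{R}^N$ be a bounded Lipschitz domain, let $s\in(0,1)$, and let $A$ be a bounded (measurable) vector field, with values in $\mathbb{R}^N$, on the convex hull of $\Omega$. Then the set of eigenvalues of the regional magnetic fractional Laplacian $(-\Delta_{2,A})^s$ in $W^{s,2}(\Omega,\mathbb{C})$ is discrete, in the sense that for every $E\in(0,\infty)$ there are only finitely many eigenvalues below $E$.
   Context: A domain is a connected open set. For an open set $\Omega\subseteq\mathbb{R}^N$, $s\in(0,1)$ and a vector field $A$ on the convex hull of $\Omega$, set $$[f]_{W^{s,2}_A(\Omega,\mathbb{C})}^2:=\iint_{\Omega\times\Omega}\frac{\left|f(x)-e^{i(x-y)\cdot A\left(\frac{x+y}{2}\right)}f(y)\right|^2}{|x-y|^{N+2s}}\,dx\,dy;$$ $W^{s,2}(\Omega,\mathbb{C})$ is the space of $f\in L^2(\Omega,\mathbb{C})$ for which this quantity with $A\equiv0$ is finite (for bounded $A$ it coincides with the space where the quantity with $A$ is finite). The regional magnetic fractional Laplacian $(-\Delta_{2,A})^s$ is given by the formula $$(-\Delta_{2,A})^sf(x)=\mathrm{p.v.}\int_\Omega\frac{f(x)-e^{i(x-y)\cdot A\left(\frac{x+y}{2}\right)}f(y)}{|x-y|^{N+2s}}\,dy,$$ understood (up to a positive constant normalization factor) as the operator associated with the quadratic form $[\cdot]^2_{W^{s,2}_A(\Omega,\mathbb{C})}$ on $W^{s,2}(\Omega,\mathbb{C})$. That is, with $$a(f,g):=\iint_{\Omega\times\Omega}\frac{\left(f(x)-e^{i(x-y)\cdot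 A\left(\frac{x+y}{2}\right)}f(y)\right)\overline{\left(g(x)-e^{i(x-y)\cdot A\left(\frac{x+y}{2}\right)}g(y)\right)}}{|x-y|^{N+2s}}\,dx\,dy,$$ a number $\lambda$ is an eigenvalue if there is a nonzero $f\in W^{s,2}(\Omega,\mathbb{C})$ with $a(f,g)=\lambda\int_\Omega f\overline g$ for all $g\in W^{s,2}(\Omega,\mathbb{C})$. *)

theory Defs
  imports "HOL-Analysis.Analysis"
begin

definition is_domain :: "'a::euclidean_space set \<Rightarrow> bool" where
  "is_domain \<Omega> \<longleftrightarrow> open \<Omega> \<and> connected \<Omega>"

(* Near each boundary point, Omega is the part of a ball lying strictly above the graph of a
   Lipschitz function. The choice of rotated coordinates is encoded by the unit vector v: the
   last coordinate of x is x \<bullet> v, the others form the orthogonal projection of x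
   onto the hyperplane v^perp. *)
definition lipschitz_boundary :: "'a::euclidean_space set \<Rightarrow> bool" where
  "lipschitz_boundary \<Omega> \<longleftrightarrow>
    (\<forall>p\<in>frontier \<Omega>. \<exists>r>0. \<exists>v::'a. \<exists>L. \<exists>\<gamma>::'a \<Rightarrow> real.
       norm v = 1 \<and> L-lipschitz_on {z. z \<bullet> v = 0} \<gamma> \<and>
       \<Omega> \<inter> ball p r = {x \<in> ball p r. \<gamma> (x - (x \<bullet> v) *\<^sub>R v) < x \<bullet> v})"

definition bounded_lipschitz_domain :: "'a::euclidean_space set \<Rightarrow> bool" where
  "bounded_lipschitz_domain \<Omega> \<longleftrightarrow>
    is_domain \<Omega> \<and> bounded \<Omega> \<and> lipschitz_boundary \<Omega>"

definition magnetic_diff ::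
    "('a::euclidean_space \<Rightarrow> 'a) \<Rightarrow> ('a \<Rightarrow> complex) \<Rightarrow> 'a \<Rightarrow> 'a \<Rightarrow> complex" where
  "magnetic_diff A f x y = f x - cis ((x - y) \<bullet> A (midpoint x y)) * f y"

(* The value is in [0, \<infinity>]. The integrand vanishes on the diagonal since
   0 powr t = 0 and division by 0 gives 0; the diagonal is a null set anyway. *)
definition magnetic_seminorm_sq ::
    "real \<Rightarrow> 'a::euclidean_space set \<Rightarrow> ('a \<Rightarrow> 'a) \<Rightarrow> ('a \<Rightarrow> complex) \<Rightarrow> ennreal" where
  "magnetic_seminorm_sq s \<Omega> A f =
    set_nn_integral lebesgue (\<Omega> \<times> \<Omega>)
      (\<lambda>(x, y). ennreal ((cmod (magnetic_diff A f x y))\<^sup>2 / norm (x - y) powr (real DIM('a) + 2 * s)))"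

(* Elements are representatives; two of them denote the same element of the function space
   if they agree almost everywhere on Omega. *)
definition sobolev_space :: "real \<Rightarrow> 'a::euclidean_space set \<Rightarrow> ('a \<Rightarrow> complex) set" where
  "sobolev_space s \<Omega> =
    {f. f \<in> borel_measurable (lebesgue_on \<Omega>) \<and>
        integrable (lebesgue_on \<Omega>) (\<lambda>x. (cmod (f x))\<^sup>2) \<and>
        magnetic_seminorm_sq s \<Omega> (\<lambda>_. 0) f < \<infinity>}"

definition magnetic_form ::
    "real \<Rightarrow> 'a::euclidean_space set \<Rightarrow> ('a \<Rightarrow> 'a) \<Rightarrow>
     ('a \<Rightarrow> complex) \<Rightarrow> ('a \<Rightarrow> complex) \<Rightarrow> complex" where
  "magnetic_form s \<Omega> A f g =
    set_lebesgue_integral lebesgue (\<Omega> \<times> \<Omega>)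
      (\<lambda>(x, y). magnetic_diff A f x y * cnj (magnetic_diff A g x y)
                 / complex_of_real (norm (x - y) powr (real DIM('a) + 2 * s)))"

(* Eigenvalues of the regional magnetic fractional Laplacian, i.e. of the operator
   associated with magnetic_form on sobolev_space. *)
definition is_eigenvalue ::
    "real \<Rightarrow> 'a::euclidean_space set \<Rightarrow> ('a \<Rightarrow> 'a) \<Rightarrow> complex \<Rightarrow> bool" where
  "is_eigenvalue s \<Omega> A \<mu> \<longleftrightarrow>
    (\<exists>f \<in> sobolev_space s \<Omega>.
       \<not> (AE x in lebesgue_on \<Omega>. f x = 0) \<and>
       (\<forall>g \<in> sobolev_space s \<Omega>.
          magnetic_form s \<Omega> A f g = \<mu> * (LINT x|lebesgue_on \<Omega>. f x * cnj (g x))))"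

end

theory Submission
  imports Defs
begin

text \<open>
  The Lipschitz boundary gives an interior ball condition, hence a lower density bound
  \<open>|\<Omega> \<inter> ball x r| \<ge> c r^N\<close> for \<open>x \<in> \<Omega>\<close> and small \<open>r\<close>. Eigenfunctions of distinct nonzero eigenvalues
  are orthogonal, and the squared magnetic seminorm of a normalised one is its eigenvalue. If this is
  at most \<open>E\<close>, then, \<open>A\<close> being bounded, the integral of \<open>|f x - f y|^2\<close> over the pairs at distance less
  than \<open>r\<close> is at most \<open>O(r^(N + 2 s) E + r^(N + 2))\<close>, which is \<open>o(r^N)\<close>. So for small \<open>r\<close> each such \<open>f\<close> is
  close in \<open>L^2\<close> to its averages over \<open>\<Omega> \<inter> ball x r\<close>. Averaging is a Hilbert-Schmidt operator: by
  Bessel's inequality the averages of all members of an orthonormal family have total square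
  norm at most \<open>|\<Omega>| / (c r^N)\<close>, which bounds the size of the family. This quantitative argument
  replaces the compact embedding of the Sobolev space into \<open>L^2\<close>.
\<close>

section \<open>Interior balls in Lipschitz domains\<close>

text \<open>Moving up by \<open>t / 2\<close> along the axis \<open>v\<close> puts the centre more
  than \<open>t / 2\<close> above the graph. A displacement \<open>w\<close> from there changes the
  height relative to the graph by at most \<open>(1 + L) * norm w\<close>, which the chosen radius
  keeps below \<open>t / 2\<close>. Staying in the inner half of \<open>ball p R\<close> with
  \<open>t \<le> R / 2\<close> ensures that the graph describes \<open>\<Omega>\<close> at every
  point used.\<close>

lemma lipschitz_graph_interior_ball:
  fixes v :: "'a::euclidean_space"
  assumes v: "norm v = 1" and lip: "L-lipschitz_on {z. z \<bullet> v = 0} \<gamma>"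
    and eq: "\<Omega> \<inter> ball p R = {x \<in> ball p R. \<gamma> (x - (x \<bullet> v) *\<^sub>R v) < x \<bullet> v}"
    and x: "x \<in> \<Omega>" "x \<in> ball p (R / 2)" and t: "0 < t" "t \<le> R / 2"
  shows "ball (x + (t / 2) *\<^sub>R v) (t / (2 * (1 + L))) \<subseteq> \<Omega> \<inter> ball x t"
proof
  fix y assume y: "y \<in> ball (x + (t / 2) *\<^sub>R v) (t / (2 * (1 + L)))"
  have L: "0 \<le> L" using lip by (rule lipschitz_on_nonneg)
  have vv: "v \<bullet> v = 1" using v by (simp add: dot_square_norm)
  define w where "w = y - x - (t / 2) *\<^sub>R v"
  have yw: "y = x + (t / 2) *\<^sub>R v + w" by (simp add: w_def)
  have nw: "norm w < t / (2 * (1 + L))"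
    using y by (simp add: w_def dist_norm norm_minus_commute algebra_simps)
  then have nw': "norm w * (1 + L) < t / 2" using L by (simp add: field_simps)
  moreover have "norm w \<le> norm w * (1 + L)" using L by (simp add: algebra_simps)
  ultimately have nw2: "norm w < t / 2" by linarith
  have wv: "\<bar>w \<bullet> v\<bar> \<le> norm w" using Cauchy_Schwarz_ineq2[of w v] v by simp
  have "norm ((t / 2) *\<^sub>R v + w) \<le> t / 2 + norm w"
    using norm_triangle_ineq[of "(t / 2) *\<^sub>R v" w] v t by simp
  moreover have "dist x y = norm ((t / 2) *\<^sub>R v + w)"
    by (simp add: w_def dist_norm norm_minus_commute)
  ultimately have yx: "dist x y < t" using nw2 by simp
  have px: "dist p x < R / 2" using x by simp
  have yR: "y \<in> ball p R" using yx px t dist_triangle[of p y x] by simp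
  have xR: "x \<in> ball p R" using px t by simp
  \<comment> \<open>\<open>P\<close> projects onto the hyperplane on which \<open>\<gamma>\<close>
    is Lipschitz; it ignores displacements along \<open>v\<close> and, by Pythagoras, does not
    lengthen \<open>w\<close>.\<close>
  define P where "P = (\<lambda>z. z - (z \<bullet> v) *\<^sub>R v)"
  have P0: "P z \<in> {z. z \<bullet> v = 0}" for z by (simp add: P_def inner_diff_left vv)
  have "\<gamma> (P x) < x \<bullet> v" using eq x xR unfolding P_def by blast
  moreover have "\<gamma> (P y) - \<gamma> (P x) \<le> L * norm (P y - P x)"
    using lipschitz_onD[OF lip P0 P0, of y x] by (simp add: dist_norm)
  moreover have "P y - P x = w - (w \<bullet> v) *\<^sub>R v"
    by (simp add: P_def yw inner_add_left vv algebra_simps)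
  moreover have "norm (w - (w \<bullet> v) *\<^sub>R v) \<le> norm w"
  proof -
    have "(norm (w - (w \<bullet> v) *\<^sub>R v))\<^sup>2 = (norm w)\<^sup>2 - (w \<bullet> v)\<^sup>2"
      by (simp only: power2_norm_eq_inner inner_diff_left inner_diff_right inner_scaleR_left
          inner_scaleR_right vv) (simp add: inner_commute power2_eq_square)
    then have "(norm (w - (w \<bullet> v) *\<^sub>R v))\<^sup>2 \<le> (norm w)\<^sup>2" by simp
    then show ?thesis by (rule power2_le_imp_le) simp
  qed
  then have "L * norm (w - (w \<bullet> v) *\<^sub>R v) \<le> L * norm w" using L by (rule mult_left_mono)
  moreover have "y \<bullet> v = x \<bullet> v + t / 2 + w \<bullet> v" by (simp add: yw inner_add_left vv)
  ultimately have "\<gamma> (P y) < y \<bullet> v" using nw' wv by (simp add: algebra_simps)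
  then have "y \<in> \<Omega>" using eq yR unfolding P_def by blast
  then show "y \<in> \<Omega> \<inter> ball x t" using yx by simp
qed

text \<open>Compactness makes the local constants uniform. A point of \<open>\<Omega>\<close> has a
  neighbourhood where \<open>\<kappa> = 1\<close> works, and a boundary point is handled by the
  graph lemma. Finitely many such neighbourhoods cover the closure, and passing to the minimal
  constants only shrinks the balls.\<close>

lemma interior_ball_condition:
  fixes \<Omega> :: "'a::euclidean_space set"
  assumes "open \<Omega>" "bounded \<Omega>" "lipschitz_boundary \<Omega>"
  obtains \<kappa> \<rho> where "0 < \<kappa>" "0 < \<rho>"
    "\<And>x t. x \<in> \<Omega> \<Longrightarrow> 0 < t \<Longrightarrow> t \<le> \<rho> \<Longrightarrow> \<exists>c. ball c (\<kappa> * t) \<subseteq> \<Omega> \<inter> ball x t"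
proof -
  define good where "good p \<kappa> \<rho> \<longleftrightarrow> 0 < \<kappa> \<and> 0 < \<rho> \<and>
    (\<forall>x t. x \<in> \<Omega> \<inter> ball p \<rho> \<longrightarrow> 0 < t \<longrightarrow> t \<le> \<rho> \<longrightarrow>
       (\<exists>c. ball c (\<kappa> * t) \<subseteq> \<Omega> \<inter> ball x t))" for p \<kappa> \<rho>
  have "\<exists>\<kappa> \<rho>. good p \<kappa> \<rho>" if "p \<in> closure \<Omega>" for p
  proof (cases "p \<in> \<Omega>")
    case True
    then obtain e where e: "e > 0" "ball p e \<subseteq> \<Omega>"
      using \<open>open \<Omega>\<close> openE by blast
    have "ball x (1 * t) \<subseteq> \<Omega> \<inter> ball x t" if "x \<in> \<Omega> \<inter> ball p (e / 2)" "0 < t" "t \<le> e / 2" for x t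
    proof -
      have "ball x t \<subseteq> ball p e" using that by (simp add: subset_ball ball_subset_ball_iff dist_commute)
      then show ?thesis using e by auto
    qed
    then have "good p 1 (e / 2)" unfolding good_def using e by (auto intro!: exI)
    then show ?thesis by blast
  next
    case False
    then have "p \<in> frontier \<Omega>" using that \<open>open \<Omega>\<close> by (simp add: frontier_def interior_open)
    then have "\<exists>r>0. \<exists>v L. \<exists>\<gamma>::'a \<Rightarrow> real.
       norm v = 1 \<and> L-lipschitz_on {z. z \<bullet> v = 0} \<gamma> \<and>
       \<Omega> \<inter> ball p r = {x \<in> ball p r. \<gamma> (x - (x \<bullet> v) *\<^sub>R v) < x \<bullet> v}"
      using assms(3) unfolding lipschitz_boundary_def by (rule bspec[rotated])
    then obtain R v L \<gamma> where R: "R > 0" and h: "norm v = 1" "L-lipschitz_on {z. z \<bullet> v = 0} \<gamma>"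
       "\<Omega> \<inter> ball p R = {x \<in> ball p R. \<gamma> (x - (x \<bullet> v) *\<^sub>R v) < x \<bullet> v}"
      by blast
    have L: "0 \<le> L" using h(2) by (rule lipschitz_on_nonneg)
    have "\<exists>c. ball c (1 / (2 * (1 + L)) * t) \<subseteq> \<Omega> \<inter> ball x t"
      if "x \<in> \<Omega> \<inter> ball p (R / 2)" "0 < t" "t \<le> R / 2" for x t
      using lipschitz_graph_interior_ball[OF h, of x t] that by auto
    then have "good p (1 / (2 * (1 + L))) (R / 2)" unfolding good_def using R L by auto
    then show ?thesis by blast
  qed
  then obtain \<kappa> \<rho> where g: "\<And>p. p \<in> closure \<Omega> \<Longrightarrow> good p (\<kappa> p) (\<rho> p)" by metis
  have "compact (closure \<Omega>)" using assms(2) by (rule compact_closure[THEN iffD2])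
  moreover have "closure \<Omega> \<subseteq> (\<Union>p\<in>closure \<Omega>. ball p (\<rho> p))"
    using g by (force simp: good_def)
  ultimately obtain C where C: "C \<subseteq> closure \<Omega>" "finite C" "closure \<Omega> \<subseteq> (\<Union>p\<in>C. ball p (\<rho> p))"
    by (rule compactE_image[OF _ open_ball])
  \<comment> \<open>The inserted 1 keeps \<open>Min\<close> meaningful when \<open>C\<close> is
    empty, which happens for empty \<open>\<Omega>\<close>.\<close>
  define k r where "k = Min (insert 1 (\<kappa> ` C))" and "r = Min (insert 1 (\<rho> ` C))"
  have "0 < k" "0 < r" using C g by (auto simp: k_def r_def good_def)
  moreover have "\<exists>c. ball c (k * t) \<subseteq> \<Omega> \<inter> ball x t" if xt: "x \<in> \<Omega>" "0 < t" "t \<le> r" for x t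
  proof -
    obtain p where p: "p \<in> C" "x \<in> ball p (\<rho> p)" using C(3) xt(1) closure_subset[of \<Omega>] by blast
    have "k \<le> \<kappa> p" "r \<le> \<rho> p" using p C by (auto simp: k_def r_def)
    moreover obtain c where "ball c (\<kappa> p * t) \<subseteq> \<Omega> \<inter> ball x t"
    proof -
      have "good p (\<kappa> p) (\<rho> p)" using g p C by blast
      moreover have "x \<in> \<Omega> \<inter> ball p (\<rho> p)" "t \<le> \<rho> p" using xt p \<open>r \<le> \<rho> p\<close> by auto
      ultimately have "\<exists>c. ball c (\<kappa> p * t) \<subseteq> \<Omega> \<inter> ball x t"
        unfolding good_def using \<open>0 < t\<close> by blast
      then show ?thesis using that by blast
    qed
    moreover have "ball c (k * t) \<subseteq> ball c (\<kappa> p * t)"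
      using \<open>k \<le> \<kappa> p\<close> xt by (intro subset_ball mult_right_mono) auto
    ultimately show ?thesis by blast
  qed
  ultimately show ?thesis using that by blast
qed

section \<open>Bessel's inequality and averages\<close>

lemma integrable_mult_cnj:
  fixes f g :: "'b \<Rightarrow> complex"
  assumes [measurable]: "f \<in> borel_measurable M" "g \<in> borel_measurable M"
    and "integrable M (\<lambda>x. (cmod (f x))\<^sup>2)" "integrable M (\<lambda>x. (cmod (g x))\<^sup>2)"
  shows "integrable M (\<lambda>x. f x * cnj (g x))"
proof (rule Bochner_Integration.integrable_bound)
  show "integrable M (\<lambda>x. (cmod (f x))\<^sup>2 + (cmod (g x))\<^sup>2)" using assms by simp
  have "cmod (f x * cnj (g x)) \<le> norm ((cmod (f x))\<^sup>2 + (cmod (g x))\<^sup>2)" for x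
  proof -
    have "0 \<le> cmod (f x) * cmod (g x)" by simp
    then have "cmod (f x) * cmod (g x) \<le> (cmod (f x))\<^sup>2 + (cmod (g x))\<^sup>2"
      using sum_squares_bound[of "cmod (f x)" "cmod (g x)"] by linarith
    then show ?thesis by (simp add: norm_mult)
  qed
  then show "AE x in M. cmod (f x * cnj (g x)) \<le> norm ((cmod (f x))\<^sup>2 + (cmod (g x))\<^sup>2)" by simp
  have [measurable]: "cnj \<in> borel_measurable borel"
    by (intro borel_measurable_continuous_onI continuous_intros)
  show "(\<lambda>x. f x * cnj (g x)) \<in> borel_measurable M" by measurable
qed

text \<open>With \<open>h\<close> the projection of \<open>g\<close> onto the span of the family,
  the integral of \<open>|g - h|^2\<close> is nonnegative. The two mixed integrals, by the choice of
  \<open>b\<close>, and the squared norm of \<open>h\<close>, by orthonormality, all equal the sum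
  of the squared coefficients, so the expansion leaves one copy of it with a minus sign.\<close>

lemma bessel_inequality:
  fixes e :: "'k \<Rightarrow> 'b \<Rightarrow> complex"
  assumes "finite K" and e[measurable]: "\<And>k. k \<in> K \<Longrightarrow> e k \<in> borel_measurable M"
    and e2: "\<And>k. k \<in> K \<Longrightarrow> integrable M (\<lambda>x. (cmod (e k x))\<^sup>2)"
    and on: "\<And>k l. k \<in> K \<Longrightarrow> l \<in> K \<Longrightarrow> (LINT x|M. e k x * cnj (e l x)) = of_bool (k = l)"
    and g[measurable]: "g \<in> borel_measurable M" and g2: "integrable M (\<lambda>x. (cmod (g x))\<^sup>2)"
  shows "(\<Sum>k\<in>K. (cmod (LINT x|M. g x * cnj (e k x)))\<^sup>2) \<le> (LINT x|M. (cmod (g x))\<^sup>2)"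
proof -
  define b where "b k = (LINT x|M. g x * cnj (e k x))" for k
  define h where "h x = (\<Sum>k\<in>K. b k * e k x)" for x
  have i1: "integrable M (\<lambda>x. g x * cnj (e k x))" "integrable M (\<lambda>x. e k x * cnj (g x))" if "k \<in> K" for k
    using that e2 g2 by (auto intro!: integrable_mult_cnj)
  have i2: "integrable M (\<lambda>x. e k x * cnj (e l x))" if "k \<in> K" "l \<in> K" for k l
    using that e2 by (auto intro!: integrable_mult_cnj)
  have i3: "integrable M (\<lambda>x. g x * cnj (g x))" using g2 by (auto intro!: integrable_mult_cnj)
  have b': "(LINT x|M. e k x * cnj (g x)) = cnj (b k)" for k
    unfolding b_def by (subst Bochner_Integration.integral_cnj[symmetric]) (simp add: mult.commute)
  have gh: "(LINT x|M. g x * cnj (h x)) = (\<Sum>k\<in>K. cnj (b k) * b k)"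
    "integrable M (\<lambda>x. g x * cnj (h x))"
  proof -
    have *: "g x * cnj (h x) = (\<Sum>k\<in>K. cnj (b k) * (g x * cnj (e k x)))" for x
      by (simp add: h_def sum_distrib_left algebra_simps)
    show "(LINT x|M. g x * cnj (h x)) = (\<Sum>k\<in>K. cnj (b k) * b k)"
      unfolding * using i1 by (subst Bochner_Integration.integral_sum) (auto simp: b_def)
    show "integrable M (\<lambda>x. g x * cnj (h x))" unfolding * using i1 by auto
  qed
  have hg: "(LINT x|M. h x * cnj (g x)) = (\<Sum>k\<in>K. cnj (b k) * b k)"
    "integrable M (\<lambda>x. h x * cnj (g x))"
  proof -
    have *: "h x * cnj (g x) = cnj (g x * cnj (h x))" for x by simp
    show "(LINT x|M. h x * cnj (g x)) = (\<Sum>k\<in>K. cnj (b k) * b k)"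
      unfolding * Bochner_Integration.integral_cnj gh by (simp add: mult.commute)
    show "integrable M (\<lambda>x. h x * cnj (g x))" unfolding * using gh(2) by (rule complex_integrable_cnj[THEN iffD2])
  qed
  have hh: "(LINT x|M. h x * cnj (h x)) = (\<Sum>k\<in>K. cnj (b k) * b k)"
    "integrable M (\<lambda>x. h x * cnj (h x))"
  proof -
    have *: "h x * cnj (h x) = (\<Sum>k\<in>K. \<Sum>l\<in>K. b k * cnj (b l) * (e k x * cnj (e l x)))" for x
      by (simp add: h_def sum_product algebra_simps)
    have "(LINT x|M. h x * cnj (h x)) = (\<Sum>k\<in>K. \<Sum>l\<in>K. b k * cnj (b l) * of_bool (k = l))"
      unfolding * using i2 on by (simp add: Bochner_Integration.integral_sum)
    also have "\<dots> = (\<Sum>k\<in>K. cnj (b k) * b k)"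
      using \<open>finite K\<close> by (intro sum.cong) (auto simp: of_bool_def if_distrib sum.delta cong: if_cong)
    finally show "(LINT x|M. h x * cnj (h x)) = (\<Sum>k\<in>K. cnj (b k) * b k)" .
    show "integrable M (\<lambda>x. h x * cnj (h x))" unfolding * using i2 by auto
  qed
  have "of_real (LINT x|M. (cmod (g x - h x))\<^sup>2) = (LINT x|M. (g x - h x) * cnj (g x - h x))"
    by (simp only: complex_norm_square[symmetric] integral_complex_of_real)
  also have "\<dots> = (LINT x|M. g x * cnj (g x) - g x * cnj (h x) - h x * cnj (g x) + h x * cnj (h x))"
    by (simp add: algebra_simps)
  also have "\<dots> = (LINT x|M. g x * cnj (g x)) - (\<Sum>k\<in>K. cnj (b k) * b k)"
    using i3 gh hg hh by simp
  also have "\<dots> = of_real ((LINT x|M. (cmod (g x))\<^sup>2) - (\<Sum>k\<in>K. (cmod (b k))\<^sup>2))"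
    by (simp only: complex_norm_square[symmetric] integral_complex_of_real of_real_diff of_real_sum mult.commute)
  finally have "(LINT x|M. (cmod (g x))\<^sup>2) - (\<Sum>k\<in>K. (cmod (b k))\<^sup>2) = (LINT x|M. (cmod (g x - h x))\<^sup>2)"
    by (simp only: of_real_eq_iff)
  also have "\<dots> \<ge> 0" by simp
  finally show ?thesis by (simp add: b_def)
qed

text \<open>This is Cauchy-Schwarz against the indicator of \<open>S\<close>, obtained as Bessel's
  inequality for a family with one member.\<close>

lemma cmod_integral_squared_le:
  fixes u :: "'b \<Rightarrow> complex"
  assumes S[measurable]: "S \<in> sets M" and fin: "emeasure M S < \<infinity>" and pos: "0 < measure M S"
    and u[measurable]: "u \<in> borel_measurable M" and u2: "integrable M (\<lambda>x. (cmod (u x))\<^sup>2)"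
  shows "(cmod (LINT x|M. u x * indicator S x))\<^sup>2 \<le> measure M S * (LINT x|M. (cmod (u x))\<^sup>2)"
proof -
  define V where "V = measure M S"
  \<comment> \<open>The family is indexed by \<open>unit\<close>; dividing by \<open>sqrt V\<close>
    normalises the indicator in L^2.\<close>
  define e where "e = (\<lambda>_::unit. \<lambda>x. complex_of_real (indicator S x / sqrt V))"
  have V: "V > 0" using pos by (simp add: V_def)
  have ee: "(cmod (e k x))\<^sup>2 = indicator S x / V" "e k x * cnj (e l x) = of_real (indicator S x / V)" for k l x
    using V by (auto simp: e_def indicator_def power2_eq_square norm_divide simp flip: of_real_mult)
  have iS: "integrable M (\<lambda>x. indicator S x :: real)" using fin by (simp add: integrable_indicator_iff)
  have "(\<Sum>k\<in>{()}. (cmod (LINT x|M. u x * cnj (e k x)))\<^sup>2) \<le> (LINT x|M. (cmod (u x))\<^sup>2)"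
  proof (rule bessel_inequality)
    show "integrable M (\<lambda>x. (cmod (e k x))\<^sup>2)" for k
      unfolding ee using iS by simp
    show "(LINT x|M. e k x * cnj (e l x)) = of_bool (k = l)" for k l
      unfolding ee integral_complex_of_real using V by (simp add: V_def[symmetric])
    show "e k \<in> borel_measurable M" for k unfolding e_def by measurable
  qed (use u2 in auto)
  moreover have "(LINT x|M. u x * cnj (e () x)) = (LINT x|M. (u x * indicator S x)) / sqrt V"
  proof -
    have "u x * cnj (e () x) = (u x * indicator S x) / sqrt V" for x
      by (auto simp: e_def indicator_def)
    then show ?thesis by simp
  qed
  ultimately have "(cmod (LINT x|M. u x * indicator S x))\<^sup>2 / V \<le> (LINT x|M. (cmod (u x))\<^sup>2)"
    using V by (simp add: norm_divide power_divide)
  then show ?thesis using V unfolding V_def[symmetric] by (simp only: pos_divide_le_eq mult.commute)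
qed

text \<open>Averaging \<open>a k = (a k - e k y) + e k y\<close> over \<open>y \<in> S\<close>, Bessel's inequality for the indicator
  of \<open>S\<close> bounds the contribution of the means of the \<open>e k\<close> independently of their number.\<close>

lemma orthonormal_sum_bound:
  fixes e :: "'k \<Rightarrow> 'b \<Rightarrow> complex"
  assumes K: "finite K" and e[measurable]: "\<And>k. k \<in> K \<Longrightarrow> e k \<in> borel_measurable M"
    and e2: "\<And>k. k \<in> K \<Longrightarrow> integrable M (\<lambda>x. (cmod (e k x))\<^sup>2)"
    and on: "\<And>k l. k \<in> K \<Longrightarrow> l \<in> K \<Longrightarrow> (LINT x|M. e k x * cnj (e l x)) = of_bool (k = l)"
    and S[measurable]: "S \<in> sets M" and fin: "emeasure M S < \<infinity>" and pos: "0 < measure M S"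
  shows "measure M S * (\<Sum>k\<in>K. (cmod (a k))\<^sup>2)
    \<le> 2 * (\<Sum>k\<in>K. LINT y|M. (cmod (a k - e k y))\<^sup>2 * indicator S y) + 2"
    and "\<And>k. k \<in> K \<Longrightarrow> integrable M (\<lambda>y. (cmod (a k - e k y))\<^sup>2 * indicator S y)"
proof -
  define V where "V = measure M S"
  \<comment> \<open>Cutting off by the indicator makes \<open>u k\<close> square integrable although
    the constant \<open>a k\<close> may fail to be so on the whole space.\<close>
  define u where "u k y = (a k - e k y) * indicator S y" for k y
  have V: "V > 0" using pos by (simp add: V_def)
  have iS: "integrable M (\<lambda>x. indicator S x :: real)" using fin by (simp add: integrable_indicator_iff)
  have iSc: "integrable M (\<lambda>x. indicator S x :: complex)"
    using integrable_of_real[OF iS, where 'a=complex] by (simp add: of_real_indicator)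
  have SV: "(LINT x|M. indicator S x :: complex) = V"
  proof -
    have "(LINT x|M. indicator S x :: complex) = (LINT x|M. complex_of_real (indicator S x))"
      by (simp add: of_real_indicator)
    then show ?thesis by (simp only: integral_complex_of_real) (simp add: V_def)
  qed
  have u2: "(cmod (u k y))\<^sup>2 = (cmod (a k - e k y))\<^sup>2 * indicator S y" for k y
    by (auto simp: u_def indicator_def)
  have um[measurable]: "u k \<in> borel_measurable M" if "k \<in> K" for k
    unfolding u_def using that by measurable
  have iu: "integrable M (\<lambda>y. (cmod (u k y))\<^sup>2)" if k: "k \<in> K" for k
  proof (rule Bochner_Integration.integrable_bound)
    show "integrable M (\<lambda>y. 2 * (cmod (a k))\<^sup>2 * indicator S y + 2 * (cmod (e k y))\<^sup>2)"
      using iS e2[OF k] by simp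
    have "(cmod (a k - e k y))\<^sup>2 \<le> 2 * (cmod (a k))\<^sup>2 + 2 * (cmod (e k y))\<^sup>2" for y
    proof -
      have "(cmod (a k - e k y))\<^sup>2 \<le> (cmod (a k) + cmod (e k y))\<^sup>2"
        by (intro power_mono norm_triangle_ineq4) auto
      also have "\<dots> \<le> 2 * (cmod (a k))\<^sup>2 + 2 * (cmod (e k y))\<^sup>2"
        using sum_squares_bound[of "cmod (a k)" "cmod (e k y)"] by (simp add: power2_sum)
      finally show ?thesis .
    qed
    then show "AE y in M. norm ((cmod (u k y))\<^sup>2)
        \<le> norm (2 * (cmod (a k))\<^sup>2 * indicator S y + 2 * (cmod (e k y))\<^sup>2)"
      by (intro AE_I2) (auto simp: u_def indicator_def)
  qed (use k in measurable)
  show "integrable M (\<lambda>y. (cmod (a k - e k y))\<^sup>2 * indicator S y)" if "k \<in> K" for k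
    using iu[OF that] by (simp add: u2)
  define D where "D k = (LINT y|M. (cmod (u k y))\<^sup>2)" for k
  define b where "b k = (LINT y|M. indicator S y * cnj (e k y))" for k
  \<comment> \<open>Integrating \<open>a k\<close> over \<open>S\<close> gives
    \<open>a k * V\<close>, hence \<open>V\<^sup>2\<close> after squaring, while Cauchy-Schwarz
    turns the deviation from the mean into \<open>V * D k\<close>. The surplus factor
    \<open>V\<close> is cancelled once the sum over \<open>k\<close> is bounded.\<close>
  have one: "V\<^sup>2 * (cmod (a k))\<^sup>2 \<le> 2 * V * D k + 2 * (cmod (b k))\<^sup>2" if k: "k \<in> K" for k
  proof -
    have S2: "integrable M (\<lambda>x. (cmod (indicator S x))\<^sup>2)"
      by (rule Bochner_Integration.integrable_cong[THEN iffD1, OF refl _ iS]) (simp add: indicator_def)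
    have ie: "integrable M (\<lambda>y. indicator S y * cnj (e k y))"
      using e2[OF k] k S2 by (intro integrable_mult_cnj) auto
    have "(LINT y|M. u k y * indicator S y) = (LINT y|M. a k * indicator S y - cnj (indicator S y * cnj (e k y)))"
      by (intro Bochner_Integration.integral_cong) (auto simp: u_def indicator_def)
    also have "\<dots> = a k * V - cnj (b k)"
      unfolding b_def using ie iSc
      by (subst Bochner_Integration.integral_diff)
        (auto simp: SV Bochner_Integration.integral_cnj simp del: complex_cnj_mult)
    finally have "a k * V = (LINT y|M. u k y * indicator S y) + cnj (b k)" by simp
    then have "cmod (a k * V) \<le> cmod (LINT y|M. u k y * indicator S y) + cmod (b k)"
      by (metis complex_mod_cnj norm_triangle_ineq)
    then have "V * cmod (a k) \<le> cmod (LINT y|M. u k y * indicator S y) + cmod (b k)"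
      using V by (simp add: norm_mult mult.commute)
    then have "(V * cmod (a k))\<^sup>2 \<le> (cmod (LINT y|M. u k y * indicator S y) + cmod (b k))\<^sup>2"
      using V by (intro power_mono) auto
    also have "\<dots> \<le> 2 * (cmod (LINT y|M. u k y * indicator S y))\<^sup>2 + 2 * (cmod (b k))\<^sup>2"
      using sum_squares_bound[of "cmod (LINT y|M. u k y * indicator S y)" "cmod (b k)"] by (simp add: power2_sum)
    also have "(cmod (LINT y|M. u k y * indicator S y))\<^sup>2 \<le> V * D k"
      unfolding V_def D_def using k S fin pos iu by (intro cmod_integral_squared_le) auto
    finally show ?thesis by (simp add: power_mult_distrib)
  qed
  have "(\<Sum>k\<in>K. (cmod (b k))\<^sup>2) \<le> (LINT x|M. (cmod (indicator S x))\<^sup>2)"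
    unfolding b_def
  proof (rule bessel_inequality[OF K e e2 on])
    show "integrable M (\<lambda>x. (cmod (indicator S x))\<^sup>2)"
      by (rule Bochner_Integration.integrable_cong[THEN iffD1, OF refl _ iS]) (simp add: indicator_def)
  qed auto
  also have "\<dots> = (LINT x|M. indicator S x)"
    by (intro Bochner_Integration.integral_cong) (auto simp: indicator_def)
  also have "\<dots> = V" by (simp add: V_def)
  finally have b: "(\<Sum>k\<in>K. (cmod (b k))\<^sup>2) \<le> V" .
  have "V\<^sup>2 * (\<Sum>k\<in>K. (cmod (a k))\<^sup>2) \<le> (\<Sum>k\<in>K. 2 * V * D k + 2 * (cmod (b k))\<^sup>2)"
    unfolding sum_distrib_left using one by (intro sum_mono)
  also have "\<dots> = 2 * V * (\<Sum>k\<in>K. D k) + 2 * (\<Sum>k\<in>K. (cmod (b k))\<^sup>2)"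
    by (simp add: sum.distrib sum_distrib_left)
  also have "\<dots> \<le> V * (2 * (\<Sum>k\<in>K. D k) + 2)" using b by (simp add: algebra_simps)
  finally have "V * (V * (\<Sum>k\<in>K. (cmod (a k))\<^sup>2)) \<le> V * (2 * (\<Sum>k\<in>K. D k) + 2)"
    by (simp add: power2_eq_square mult.assoc)
  then have "V * (\<Sum>k\<in>K. (cmod (a k))\<^sup>2) \<le> 2 * (\<Sum>k\<in>K. D k) + 2"
    using V by simp
  then show "measure M S * (\<Sum>k\<in>K. (cmod (a k))\<^sup>2)
    \<le> 2 * (\<Sum>k\<in>K. LINT y|M. (cmod (a k - e k y))\<^sup>2 * indicator S y) + 2"
    by (simp add: V_def D_def u2)
qed

section \<open>Borel representatives and null sets of pairs\<close>

text \<open>Sobolev functions are Lebesgue measurable on \<open>\<Omega>\<close>, whereas Tonelli's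
  theorem is used for \<open>lborel\<close>, whose products are again \<open>lborel\<close>.
  Completion changes measurable functions only on null sets, so real and imaginary part each have a
  Borel version. The value 0 off \<open>\<Omega>\<close> turns integrals over
  \<open>\<Omega>\<close> into integrals over the whole space.\<close>

lemma borel_representative:
  fixes f :: "'a::euclidean_space \<Rightarrow> complex"
  assumes f: "f \<in> borel_measurable (lebesgue_on \<Omega>)" and \<Omega>: "\<Omega> \<in> sets borel"
  obtains F where "F \<in> borel_measurable borel" "AE x in lborel. x \<in> \<Omega> \<longrightarrow> F x = f x"
    "\<And>x. x \<notin> \<Omega> \<Longrightarrow> F x = 0"
proof -
  define g where "g x = (if x \<in> \<Omega> then f x else 0)" for x
  have "\<Omega> \<in> sets lebesgue" using \<Omega> by simp
  then have g: "g \<in> borel_measurable lebesgue"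
    using f unfolding g_def by (subst borel_measurable_if) auto
  have "(\<lambda>x. Re (g x)) \<in> borel_measurable lebesgue" "(\<lambda>x. Im (g x)) \<in> borel_measurable lebesgue"
    using g by measurable
  then obtain u v where [measurable]: "u \<in> borel_measurable lborel" "v \<in> borel_measurable lborel"
    and ae: "AE x in lborel. Re (g x) = u x" "AE x in lborel. Im (g x) = v x"
    by (metis completion_ex_borel_measurable_real)
  define F where "F x = indicator \<Omega> x * (of_real (u x) + \<i> * of_real (v x))" for x
  have "AE x in lborel. x \<in> \<Omega> \<longrightarrow> F x = f x"
    using ae by eventually_elim (auto simp: F_def g_def complex_eq_iff)
  moreover have "F \<in> borel_measurable borel"
    unfolding F_def using \<Omega> by measurable
  moreover have "F x = 0" if "x \<notin> \<Omega>" for x using that by (simp add: F_def)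
  ultimately show ?thesis using that by blast
qed

text \<open>The exceptional pairs lie in two strips over null sets, which are null in the product.
  This carries almost everywhere equality of functions of one variable over to expressions in two
  points.\<close>

lemma AE_lborel_Times:
  fixes P :: "'a::euclidean_space \<Rightarrow> bool" and Q :: "'b::euclidean_space \<Rightarrow> bool"
  assumes "AE x in lborel. P x" "AE y in lborel. Q y"
  shows "AE z in (lborel :: ('a \<times> 'b) measure). P (fst z) \<and> Q (snd z)"
proof -
  obtain N1 where N1: "{x. \<not> P x} \<subseteq> N1" "N1 \<in> null_sets lborel"
    using assms(1) unfolding eventually_ae_filter by auto
  obtain N2 where N2: "{x. \<not> Q x} \<subseteq> N2" "N2 \<in> null_sets lborel"
    using assms(2) unfolding eventually_ae_filter by auto
  have "N1 \<times> UNIV \<in> null_sets (lborel \<Otimes>\<^sub>M (lborel :: 'b measure))"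
    using N1(2) by (auto simp: null_sets_def lborel.emeasure_pair_measure_Times)
  moreover have "UNIV \<times> N2 \<in> null_sets ((lborel :: 'a measure) \<Otimes>\<^sub>M lborel)"
    using N2(2) by (auto simp: null_sets_def lborel.emeasure_pair_measure_Times)
  ultimately have "N1 \<times> UNIV \<union> UNIV \<times> N2 \<in> null_sets (lborel :: ('a \<times> 'b) measure)"
    unfolding lborel_prod by (rule null_sets.Un)
  then show ?thesis
    by (rule AE_I') (use N1 N2 in auto)
qed

section \<open>Oscillation at small distances\<close>

text \<open>The left side is \<open>2 * \<bar>sin (t / 2)\<bar>\<close>, a chord no longer than its
  arc.\<close>

lemma norm_cis_minus_1_le: "cmod (cis t - 1) \<le> \<bar>t\<bar>"
  using dist_exp_i_1[of t] abs_sin_x_le_abs_x[of "t / 2"] by (simp add: cis_conv_exp)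

text \<open>Removing the phase costs at most \<open>C * dist x y * cmod (f y)\<close>, because the
  phase differs from 1 by at most its angle. The factor \<open>dist x y\<close> makes this error
  small on close pairs.\<close>

lemma cmod_diff_le_magnetic_diff:
  fixes A :: "'a::euclidean_space \<Rightarrow> 'a"
  assumes "norm (A (midpoint x y)) \<le> C"
  shows "(cmod (f x - f y))\<^sup>2 \<le> 2 * (cmod (magnetic_diff A f x y))\<^sup>2 + 2 * C\<^sup>2 * (dist x y)\<^sup>2 * (cmod (f y))\<^sup>2"
proof -
  define t where "t = (x - y) \<bullet> A (midpoint x y)"
  have "\<bar>t\<bar> \<le> norm (x - y) * norm (A (midpoint x y))"
    unfolding t_def by (rule Cauchy_Schwarz_ineq2)
  also have "\<dots> \<le> dist x y * C" using assms by (simp add: dist_norm mult_left_mono)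
  finally have t: "cmod (cis t - 1) \<le> C * dist x y"
    using norm_cis_minus_1_le[of t] by (simp add: mult.commute)
  have "f x - f y = magnetic_diff A f x y + (cis t - 1) * f y"
    by (simp add: magnetic_diff_def t_def algebra_simps)
  then have "cmod (f x - f y) \<le> cmod (magnetic_diff A f x y) + cmod (cis t - 1) * cmod (f y)"
    by (metis norm_mult norm_triangle_ineq)
  also have "\<dots> \<le> cmod (magnetic_diff A f x y) + C * dist x y * cmod (f y)"
    using t by (intro add_left_mono mult_right_mono) auto
  finally have "(cmod (f x - f y))\<^sup>2 \<le> (cmod (magnetic_diff A f x y) + C * dist x y * cmod (f y))\<^sup>2"
    by (intro power_mono) auto
  also have "\<dots> \<le> 2 * (cmod (magnetic_diff A f x y))\<^sup>2 + 2 * (C * dist x y * cmod (f y))\<^sup>2"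
    using sum_squares_bound[of "cmod (magnetic_diff A f x y)" "C * dist x y * cmod (f y)"]
    by (simp add: power2_sum)
  finally show ?thesis by (simp add: power_mult_distrib)
qed

definition close_pairs :: "'a::euclidean_space set \<Rightarrow> real \<Rightarrow> ('a \<times> 'a) set" where
  "close_pairs \<Omega> r = {z. fst z \<in> \<Omega> \<and> snd z \<in> \<Omega> \<and> dist (fst z) (snd z) < r}"

lemma sets_close_pairs [measurable]:
  assumes "open \<Omega>"
  shows "close_pairs \<Omega> r \<in> sets (borel \<Otimes>\<^sub>M borel)"
proof -
  have "close_pairs \<Omega> r = \<Omega> \<times> \<Omega> \<inter> {z. dist (fst z) (snd z) < r}"
    by (auto simp: close_pairs_def)
  moreover have "open {z::'a \<times> 'a. dist (fst z) (snd z) < r}"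
    by (intro open_Collect_less continuous_intros)
  ultimately have "open (close_pairs \<Omega> r)" using assms by (auto intro: open_Times)
  then have "close_pairs \<Omega> r \<in> sets borel" by (rule borel_open)
  then show ?thesis unfolding borel_prod .
qed

text \<open>On close pairs the singular weight helps: the squared magnetic difference is at most
  r^(N + 2 s) times the form integrand \<open>H\<close>. The error from removing the phase is at
  most a multiple of r^2 times the square at \<open>y\<close>, and for fixed \<open>y\<close> the
  admissible \<open>x\<close> fill at most a ball of radius \<open>r\<close>. Both terms are of
  higher order in \<open>r\<close> than the volume r^N of a ball.\<close>

lemma local_oscillation_bound:
  fixes \<Omega> :: "'a::euclidean_space set" and A :: "'a \<Rightarrow> 'a" and f F :: "'a \<Rightarrow> complex" and s r C :: real
  defines "H \<equiv> \<lambda>z. indicator (\<Omega> \<times> \<Omega>) z *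
    ((cmod (magnetic_diff A f (fst z) (snd z)))\<^sup>2 / norm (fst z - snd z) powr (real DIM('a) + 2 * s))"
  assumes \<Omega>: "open \<Omega>" and s: "0 < s" and r: "0 < r"
    and C: "\<And>x. x \<in> convex hull \<Omega> \<Longrightarrow> norm (A x) \<le> C"
    and F[measurable]: "F \<in> borel_measurable borel" and Ff: "AE x in lborel. x \<in> \<Omega> \<longrightarrow> F x = f x"
    and F2: "integrable lborel (\<lambda>x. (cmod (F x))\<^sup>2)"
    and H: "integrable lebesgue H"
  shows "(\<integral>\<^sup>+ z. ennreal ((cmod (F (fst z) - F (snd z)))\<^sup>2 * indicator (close_pairs \<Omega> r) z) \<partial>lborel)
    \<le> ennreal (2 * r powr (real DIM('a) + 2 * s) * (LINT z|lebesgue. H z)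
        + 2 * C\<^sup>2 * r\<^sup>2 * measure lborel (ball (0::'a) r) * (LINT x|lborel. (cmod (F x))\<^sup>2))"
proof -
  define p where "p = real DIM('a) + 2 * s"
  define T where "T = close_pairs \<Omega> r"
  define \<psi> where "\<psi> z = (cmod (F (snd z)))\<^sup>2 * indicator T z" for z
  have [measurable]: "T \<in> sets (borel \<Otimes>\<^sub>M borel)" unfolding T_def using \<Omega> by measurable
  have \<psi>m[measurable]: "\<psi> \<in> borel_measurable (borel \<Otimes>\<^sub>M borel)" unfolding \<psi>_def by measurable
  have p: "p > 0" using s by (simp add: p_def add_nonneg_pos)
  have Hnn: "0 \<le> H z" for z by (simp add: H_def)
  have pt: "(cmod (F (fst z) - F (snd z)))\<^sup>2 * indicator T z \<le> 2 * r powr p * H z + 2 * C\<^sup>2 * r\<^sup>2 * \<psi> z"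
    if z: "fst z \<in> \<Omega> \<longrightarrow> F (fst z) = f (fst z)" "snd z \<in> \<Omega> \<longrightarrow> F (snd z) = f (snd z)" for z
  proof (cases "z \<in> T \<and> fst z \<noteq> snd z")
    \<comment> \<open>Off \<open>T\<close> the indicator vanishes, on the diagonal the difference
      does. Splitting off the diagonal leaves a nonzero distance, whose power can be cancelled in
      the other case.\<close>
    case False
    then have "(cmod (F (fst z) - F (snd z)))\<^sup>2 * indicator T z = 0" by auto
    moreover have "0 \<le> 2 * r powr p * H z + 2 * C\<^sup>2 * r\<^sup>2 * \<psi> z"
      using Hnn[of z] by (intro add_nonneg_nonneg mult_nonneg_nonneg) (auto simp: \<psi>_def)
    ultimately show ?thesis by linarith
  next
    case True
    obtain x y where xy: "z = (x, y)" by (cases z)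
    have \<Omega>xy: "x \<in> \<Omega>" "y \<in> \<Omega>" and d: "dist x y < r" "x \<noteq> y" using True by (auto simp: xy T_def close_pairs_def)
    define m where "m = (cmod (magnetic_diff A f x y))\<^sup>2"
    have "midpoint x y \<in> convex hull \<Omega>"
      using \<Omega>xy convex_convex_hull[of \<Omega>] hull_subset[of \<Omega> convex]
      by (meson in_mono midpoint_in_closed_segment closed_segment_subset)
    then have "(cmod (f x - f y))\<^sup>2 \<le> 2 * m + 2 * C\<^sup>2 * (dist x y)\<^sup>2 * (cmod (f y))\<^sup>2"
      unfolding m_def by (intro cmod_diff_le_magnetic_diff C)
    also have "m = norm (x - y) powr p * (m / norm (x - y) powr p)" using d by simp
    also have "\<dots> \<le> r powr p * (m / norm (x - y) powr p)"
      using d p by (intro mult_right_mono powr_mono2) (auto simp: m_def dist_norm)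
    also have "m / norm (x - y) powr p = H z" using \<Omega>xy by (simp add: H_def xy m_def p_def)
    also have "(dist x y)\<^sup>2 \<le> r\<^sup>2" using d by (intro power_mono) auto
    finally have "(cmod (f x - f y))\<^sup>2 \<le> 2 * (r powr p * H z) + 2 * C\<^sup>2 * r\<^sup>2 * (cmod (f y))\<^sup>2"
      by (simp add: mult_left_mono mult_right_mono)
    then show ?thesis using True z \<Omega>xy by (simp add: xy \<psi>_def)
  qed
  have ae: "AE z in (lebesgue :: ('a \<times> 'a) measure). (fst z \<in> \<Omega> \<longrightarrow> F (fst z) = f (fst z)) \<and> (snd z \<in> \<Omega> \<longrightarrow> F (snd z) = f (snd z))"
    by (rule AE_completion) (rule AE_lborel_Times[OF Ff Ff])
  have \<psi>leb: "\<psi> \<in> borel_measurable lebesgue"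
    by (rule measurable_completion) (use \<psi>m in \<open>simp add: borel_prod\<close>)
  have I\<psi>: "(\<integral>\<^sup>+ z. ennreal (\<psi> z) \<partial>lborel)
     \<le> ennreal (measure lborel (ball (0::'a) r) * (LINT x|lborel. (cmod (F x))\<^sup>2))"
  proof -
    have "(\<integral>\<^sup>+ z. ennreal (\<psi> z) \<partial>lborel) = (\<integral>\<^sup>+ z. ennreal (\<psi> z) \<partial>(lborel \<Otimes>\<^sub>M lborel))"
      by (simp add: lborel_prod)
    \<comment> \<open>\<open>\<psi>\<close> depends on the first point only through the indicator of
      \<open>T\<close>, so that point is integrated out first.\<close>
    also have "\<dots> = (\<integral>\<^sup>+ y. \<integral>\<^sup>+ x. ennreal (\<psi> (x, y)) \<partial>lborel \<partial>lborel)"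
      by (subst lborel_pair.nn_integral_snd[symmetric]) measurable
    also have "\<dots> \<le> (\<integral>\<^sup>+ y. ennreal (measure lborel (ball (0::'a) r)) * ennreal ((cmod (F y))\<^sup>2) \<partial>lborel)"
    proof (rule nn_integral_mono)
      fix y :: 'a
      have "(\<integral>\<^sup>+ x. ennreal (\<psi> (x, y)) \<partial>lborel)
          \<le> (\<integral>\<^sup>+ x. ennreal ((cmod (F y))\<^sup>2) * indicator (ball y r) x \<partial>lborel)"
        by (intro nn_integral_mono)
          (auto simp: \<psi>_def T_def close_pairs_def indicator_def dist_commute)
      also have "\<dots> = ennreal ((cmod (F y))\<^sup>2) * emeasure lborel (ball y r)"
        by (simp add: nn_integral_cmult_indicator)
      also have "emeasure lborel (ball y r) = ennreal (measure lborel (ball y r))"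
        using emeasure_lborel_ball_finite[of y r] by (simp add: emeasure_eq_ennreal_measure)
      also have "measure lborel (ball y r) = measure lborel (ball (0::'a) r)"
        using r content_ball_conv_unit_ball[of r y] content_ball_conv_unit_ball[of r "0::'a"]
        by simp
      finally show "(\<integral>\<^sup>+ x. ennreal (\<psi> (x, y)) \<partial>lborel)
          \<le> ennreal (measure lborel (ball (0::'a) r)) * ennreal ((cmod (F y))\<^sup>2)"
        by (simp add: mult.commute)
    qed
    also have "\<dots> = ennreal (measure lborel (ball (0::'a) r)) * (\<integral>\<^sup>+ y. ennreal ((cmod (F y))\<^sup>2) \<partial>lborel)"
      by (rule nn_integral_cmult) measurable
    also have "(\<integral>\<^sup>+ y. ennreal ((cmod (F y))\<^sup>2) \<partial>lborel) = ennreal (LINT x|lborel. (cmod (F x))\<^sup>2)"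
      using F2 by (intro nn_integral_eq_integral) auto
    finally show ?thesis by (simp add: ennreal_mult)
  qed
  \<comment> \<open>The form integrand contains \<open>f\<close> itself and is only known to be
    Lebesgue measurable, so the comparison takes place on \<open>lebesgue\<close>; completing the
    measure does not change nonnegative integrals.\<close>
  have "(\<integral>\<^sup>+ z. ennreal ((cmod (F (fst z) - F (snd z)))\<^sup>2 * indicator T z) \<partial>lborel)
    = (\<integral>\<^sup>+ z. ennreal ((cmod (F (fst z) - F (snd z)))\<^sup>2 * indicator T z) \<partial>lebesgue)"
    by (simp add: nn_integral_completion)
  also have "\<dots> \<le> (\<integral>\<^sup>+ z. ennreal (2 * r powr p) * ennreal (H z) + ennreal (2 * C\<^sup>2 * r\<^sup>2) * ennreal (\<psi> z) \<partial>lebesgue)"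
  proof (rule nn_integral_mono_AE, use ae in eventually_elim)
    case (elim z)
    then have "(cmod (F (fst z) - F (snd z)))\<^sup>2 * indicator T z \<le> 2 * r powr p * H z + 2 * C\<^sup>2 * r\<^sup>2 * \<psi> z"
      using pt by blast
    then show ?case
      using Hnn by (simp add: \<psi>_def ennreal_mult[symmetric] ennreal_plus[symmetric] ennreal_leI del: ennreal_plus)
  qed
  also have "\<dots> = ennreal (2 * r powr p) * (\<integral>\<^sup>+ z. ennreal (H z) \<partial>lebesgue)
      + ennreal (2 * C\<^sup>2 * r\<^sup>2) * (\<integral>\<^sup>+ z. ennreal (\<psi> z) \<partial>lebesgue)"
    using borel_measurable_integrable[OF H] \<psi>leb
    by (subst nn_integral_add) (auto simp: nn_integral_cmult)
  also have "(\<integral>\<^sup>+ z. ennreal (H z) \<partial>lebesgue) = ennreal (LINT z|lebesgue. H z)"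
    using H Hnn by (intro nn_integral_eq_integral) auto
  also have "(\<integral>\<^sup>+ z. ennreal (\<psi> z) \<partial>lebesgue) = (\<integral>\<^sup>+ z. ennreal (\<psi> z) \<partial>lborel)"
    by (simp add: nn_integral_completion)
  also have "ennreal (2 * r powr p) * ennreal (LINT z|lebesgue. H z)
      + ennreal (2 * C\<^sup>2 * r\<^sup>2) * (\<integral>\<^sup>+ z. ennreal (\<psi> z) \<partial>lborel)
    \<le> ennreal (2 * r powr p) * ennreal (LINT z|lebesgue. H z)
      + ennreal (2 * C\<^sup>2 * r\<^sup>2)
        * ennreal (measure lborel (ball (0::'a) r) * (LINT x|lborel. (cmod (F x))\<^sup>2))"
    using I\<psi> by (intro add_left_mono mult_left_mono) auto
  also have "\<dots> = ennreal (2 * r powr p * (LINT z|lebesgue. H z)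
      + 2 * C\<^sup>2 * r\<^sup>2 * measure lborel (ball (0::'a) r) * (LINT x|lborel. (cmod (F x))\<^sup>2))"
  proof -
    have "0 \<le> (LINT z|lebesgue. H z)" using Hnn by (intro Bochner_Integration.integral_nonneg)
    moreover have "0 \<le> measure lborel (ball (0::'a) r) * (LINT x|lborel. (cmod (F x))\<^sup>2)" by simp
    ultimately show ?thesis
      by (subst (1 2) ennreal_mult[symmetric]) (auto simp: mult.assoc intro!: ennreal_plus[symmetric])
  qed
  finally show ?thesis unfolding T_def p_def .
qed

section \<open>Counting orthonormal functions\<close>

text \<open>The pointwise bound \<open>orthonormal_sum_bound\<close> is integrated over
  \<open>x \<in> \<Omega>\<close>. On the left the squares integrate to 1 each; on the right the
  oscillations give at most \<open>\<eta>\<close> each and the constant 2 gives twice the volume of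
  \<open>\<Omega>\<close>. Once \<open>\<eta>\<close> is below \<open>v / 2\<close>, this bounds the
  cardinality.\<close>

lemma orthonormal_card_bound:
  fixes \<Omega> :: "'a::euclidean_space set" and e :: "'k \<Rightarrow> 'a \<Rightarrow> complex" and v r \<eta> :: real
  assumes \<Omega>: "open \<Omega>" "bounded \<Omega>" and v: "0 < v"
    and dens: "\<And>x. x \<in> \<Omega> \<Longrightarrow> v \<le> measure lborel (\<Omega> \<inter> ball x r)"
    and K: "finite K" and e[measurable]: "\<And>k. k \<in> K \<Longrightarrow> e k \<in> borel_measurable borel"
    and e2: "\<And>k. k \<in> K \<Longrightarrow> integrable lborel (\<lambda>x. (cmod (e k x))\<^sup>2)"
    and on: "\<And>k l. k \<in> K \<Longrightarrow> l \<in> K \<Longrightarrow> (LINT x|lborel. e k x * cnj (e l x)) = of_bool (k = l)"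
    and e0: "\<And>k x. k \<in> K \<Longrightarrow> x \<notin> \<Omega> \<Longrightarrow> e k x = 0"
    and \<eta>: "0 \<le> \<eta>" and osc: "\<And>k. k \<in> K \<Longrightarrow>
      (\<integral>\<^sup>+ z. ennreal ((cmod (e k (fst z) - e k (snd z)))\<^sup>2 * indicator (close_pairs \<Omega> r) z) \<partial>lborel) \<le> ennreal \<eta>"
  shows "v * card K \<le> 2 * (card K * \<eta>) + 2 * measure lborel \<Omega>"
proof -
  define T where "T = close_pairs \<Omega> r"
  \<comment> \<open>\<open>D\<close> takes values in [0, \<infinity>], so Tonelli gives its
    measurability and its integral before the inner integrals are known to be finite.\<close>
  define D where "D k x = (\<integral>\<^sup>+ y. ennreal ((cmod (e k x - e k y))\<^sup>2 * indicator T (x, y)) \<partial>lborel)" for k x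
  have [measurable]: "T \<in> sets (borel \<Otimes>\<^sub>M borel)" unfolding T_def using \<Omega> by measurable
  have [measurable]: "\<Omega> \<in> sets borel" using \<Omega> by simp
  have \<phi>m: "(\<lambda>z. ennreal ((cmod (e k (fst z) - e k (snd z)))\<^sup>2 * indicator T z)) \<in> borel_measurable (lborel \<Otimes>\<^sub>M lborel)"
    if "k \<in> K" for k using that by measurable
  have Dm[measurable]: "D k \<in> borel_measurable borel" if "k \<in> K" for k
    using lborel.borel_measurable_nn_integral_fst[OF \<phi>m[OF that]] unfolding D_def by simp
  have DI: "(\<integral>\<^sup>+ x. D k x \<partial>lborel) \<le> ennreal \<eta>" if "k \<in> K" for k
    using lborel.nn_integral_fst[OF \<phi>m[OF that]] osc[OF that] unfolding D_def T_def by (simp add: lborel_prod)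
  have fin\<Omega>: "emeasure lborel \<Omega> < \<infinity>" using \<Omega> by (intro emeasure_bounded_finite)
  have pt: "ennreal (v * (\<Sum>k\<in>K. (cmod (e k x))\<^sup>2)) \<le> 2 * (\<Sum>k\<in>K. D k x) + 2 * indicator \<Omega> x" for x
  proof (cases "x \<in> \<Omega>")
    case False
    then show ?thesis using e0 by simp
  next
    case True
    define S where "S = \<Omega> \<inter> ball x r"
    have S: "S \<in> sets lborel" "0 < measure lborel S" "emeasure lborel S < \<infinity>"
      using dens[OF True] v \<Omega> emeasure_bounded_finite[of S] unfolding S_def by (auto simp: bounded_Int)
    have e': "k \<in> K \<Longrightarrow> e k \<in> borel_measurable lborel" for k using e by simp
    \<comment> \<open>The free constants \<open>a k\<close> become the values at the centre
      \<open>x\<close>; the averaging set is the part of \<open>\<Omega>\<close> within distance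
      \<open>r\<close>.\<close>
    note b = orthonormal_sum_bound[OF K e' e2 on S(1) S(3) S(2), where a = "\<lambda>k. e k x"]
    have D: "D k x = ennreal (LINT y|lborel. (cmod (e k x - e k y))\<^sup>2 * indicator S y)" if "k \<in> K" for k
    proof -
      have "D k x = (\<integral>\<^sup>+ y. ennreal ((cmod (e k x - e k y))\<^sup>2 * indicator S y) \<partial>lborel)"
        unfolding D_def using True
        by (intro nn_integral_cong) (auto simp: T_def S_def close_pairs_def indicator_def)
      also have "\<dots> = ennreal (LINT y|lborel. (cmod (e k x - e k y))\<^sup>2 * indicator S y)"
        using b(2) that by (intro nn_integral_eq_integral) auto
      finally show ?thesis .
    qed
    have "v * (\<Sum>k\<in>K. (cmod (e k x))\<^sup>2) \<le> measure lborel S * (\<Sum>k\<in>K. (cmod (e k x))\<^sup>2)"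
      using dens[OF True] unfolding S_def by (intro mult_right_mono sum_nonneg) auto
    also note b(1)
    finally have "ennreal (v * (\<Sum>k\<in>K. (cmod (e k x))\<^sup>2))
      \<le> ennreal (2 * (\<Sum>k\<in>K. LINT y|lborel. (cmod (e k x - e k y))\<^sup>2 * indicator S y) + 2)"
      by (rule ennreal_leI)
    also have "\<dots> = 2 * (\<Sum>k\<in>K. D k x) + 2"
      using D by (simp add: ennreal_mult sum_nonneg)
    finally show ?thesis using True by simp
  qed
  have "ennreal (v * card K) = (\<integral>\<^sup>+ x. ennreal (v * (\<Sum>k\<in>K. (cmod (e k x))\<^sup>2)) \<partial>lborel)"
  proof -
    have "(LINT x|lborel. (cmod (e k x))\<^sup>2) = 1" if "k \<in> K" for k
    proof -
      have "complex_of_real (LINT x|lborel. (cmod (e k x))\<^sup>2) = 1"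
        using on[OF that that] by (simp only: complex_norm_square[symmetric] integral_complex_of_real) simp
      then show ?thesis by simp
    qed
    then have "(LINT x|lborel. v * (\<Sum>k\<in>K. (cmod (e k x))\<^sup>2)) = v * card K"
      using e2 by (simp add: Bochner_Integration.integral_sum)
    moreover have "integrable lborel (\<lambda>x. v * (\<Sum>k\<in>K. (cmod (e k x))\<^sup>2))" using e2 by auto
    ultimately show ?thesis using v by (subst nn_integral_eq_integral) (auto simp: sum_nonneg)
  qed
  also have "\<dots> \<le> (\<integral>\<^sup>+ x. 2 * (\<Sum>k\<in>K. D k x) + 2 * indicator \<Omega> x \<partial>lborel)"
    using pt by (intro nn_integral_mono)
  also have "\<dots> = 2 * (\<Sum>k\<in>K. \<integral>\<^sup>+ x. D k x \<partial>lborel) + 2 * emeasure lborel \<Omega>"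
    by (subst nn_integral_add) (auto simp: nn_integral_cmult nn_integral_sum)
  also have "\<dots> \<le> 2 * (\<Sum>k\<in>K. ennreal \<eta>) + 2 * emeasure lborel \<Omega>"
    using DI by (intro add_right_mono mult_left_mono sum_mono) auto
  also have "\<dots> = ennreal (2 * (card K * \<eta>) + 2 * measure lborel \<Omega>)"
    using fin\<Omega> \<eta> by (simp add: emeasure_eq_ennreal_measure ennreal_mult ennreal_of_nat_eq_real_of_nat)
  finally show ?thesis using \<eta> by (subst (asm) ennreal_le_iff) auto
qed

section \<open>Eigenvalues and eigenfunctions\<close>

text \<open>Conjugation commutes with the Bochner integral, also where that integral has its default
  value 0.\<close>

lemma magnetic_form_commute: "magnetic_form s \<Omega> A g f = cnj (magnetic_form s \<Omega> A f g)"
  unfolding magnetic_form_def set_lebesgue_integral_def Bochner_Integration.integral_cnj[symmetric]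
  by (intro Bochner_Integration.integral_cong) (auto simp: mult.commute split: prod.split)

text \<open>For a nonzero eigenvalue the form does not vanish at the eigenfunction, so the integrand is
  integrable: a Bochner integral of a non-integrable function is 0.\<close>

lemma eigenvalue_form:
  fixes \<Omega> :: "'a::euclidean_space set" and f :: "'a \<Rightarrow> complex" and \<mu> :: complex
    and A :: "'a \<Rightarrow> 'a" and s I :: real
  defines "H \<equiv> \<lambda>z. indicator (\<Omega> \<times> \<Omega>) z *
    ((cmod (magnetic_diff A f (fst z) (snd z)))\<^sup>2 / norm (fst z - snd z) powr (real DIM('a) + 2 * s))"
  assumes \<mu>: "\<mu> \<noteq> 0" and I: "0 < I"
    and form: "magnetic_form s \<Omega> A f f = \<mu> * of_real I"
  shows "integrable lebesgue H" and "(LINT z|lebesgue. H z) = Re \<mu> * I" and "Im \<mu> = 0"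
proof -
  have "magnetic_form s \<Omega> A f f = (LINT z|lebesgue. of_real (H z))"
    unfolding magnetic_form_def set_lebesgue_integral_def
    by (intro Bochner_Integration.integral_cong)
      (auto simp: H_def indicator_def complex_norm_square[symmetric] simp flip: of_real_power)
  then have *: "of_real (LINT z|lebesgue. H z) = \<mu> * of_real I"
    using form by simp
  then have "(LINT z|lebesgue. H z) \<noteq> 0" using \<mu> I by auto
  then show "integrable lebesgue H" using not_integrable_integral_eq by blast
  show "(LINT z|lebesgue. H z) = Re \<mu> * I" using arg_cong[OF *, of Re] by simp
  show "Im \<mu> = 0" using arg_cong[OF *, of Im] I by simp
qed

lemma integral_lebesgue_on_representative:
  fixes f g F G :: "'a::euclidean_space \<Rightarrow> complex"
  assumes \<Omega>: "\<Omega> \<in> sets borel"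
    and F: "F \<in> borel_measurable borel" "AE x in lborel. x \<in> \<Omega> \<longrightarrow> F x = f x" "\<And>x. x \<notin> \<Omega> \<Longrightarrow> F x = 0"
    and G: "G \<in> borel_measurable borel" "AE x in lborel. x \<in> \<Omega> \<longrightarrow> G x = g x"
    and f: "f \<in> borel_measurable (lebesgue_on \<Omega>)" and g: "g \<in> borel_measurable (lebesgue_on \<Omega>)"
  shows "(LINT x|lebesgue_on \<Omega>. f x * cnj (g x)) = (LINT x|lborel. F x * cnj (G x))"
proof -
  have cnj_m: "cnj \<in> borel_measurable borel"
    by (intro borel_measurable_continuous_onI continuous_intros)
  have FG: "(\<lambda>x. F x * cnj (G x)) \<in> borel_measurable lborel"
    using F(1) measurable_compose[OF G(1) cnj_m] by simp
  have fg: "(\<lambda>x. f x * cnj (g x)) \<in> borel_measurable (lebesgue_on \<Omega>)"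
    using f measurable_compose[OF g cnj_m] by simp
  have S: "\<Omega> \<inter> space lebesgue \<in> sets lebesgue" using \<Omega> by simp
  have "(LINT x|lebesgue_on \<Omega>. f x * cnj (g x)) = (LINT x|lebesgue. indicator \<Omega> x *\<^sub>R (f x * cnj (g x)))"
    by (rule Bochner_Integration.integral_restrict_space[OF S])
  also have "\<dots> = (LINT x|lebesgue. F x * cnj (G x))"
  proof (rule integral_cong_AE)
    show "(\<lambda>x. indicator \<Omega> x *\<^sub>R (f x * cnj (g x))) \<in> borel_measurable lebesgue"
      using fg by (rule borel_measurable_restrict_space_iff[OF S, THEN iffD1])
    show "(\<lambda>x. F x * cnj (G x)) \<in> borel_measurable lebesgue"
      using FG by (rule measurable_completion)
    have "AE x in lborel. indicator \<Omega> x *\<^sub>R (f x * cnj (g x)) = F x * cnj (G x)"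
      using F(2) G(2) by eventually_elim (use F(3) in \<open>auto simp: indicator_def\<close>)
    then show "AE x in lebesgue. indicator \<Omega> x *\<^sub>R (f x * cnj (g x)) = F x * cnj (G x)"
      by (rule AE_completion)
  qed
  also have "\<dots> = (LINT x|lborel. F x * cnj (G x))" using FG by (rule integral_completion)
  finally show ?thesis .
qed

lemma integrable_representative:
  fixes f F :: "'a::euclidean_space \<Rightarrow> complex"
  assumes \<Omega>: "\<Omega> \<in> sets borel"
    and F: "F \<in> borel_measurable borel" "AE x in lborel. x \<in> \<Omega> \<longrightarrow> F x = f x" "\<And>x. x \<notin> \<Omega> \<Longrightarrow> F x = 0"
    and f: "integrable (lebesgue_on \<Omega>) (\<lambda>x. (cmod (f x))\<^sup>2)"
  shows "integrable lborel (\<lambda>x. (cmod (F x))\<^sup>2)"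
proof -
  have S: "\<Omega> \<inter> space lebesgue \<in> sets lebesgue" using \<Omega> by simp
  have Fm: "(\<lambda>x. (cmod (F x))\<^sup>2) \<in> borel_measurable lborel" using F(1) by measurable
  have i: "integrable lebesgue (\<lambda>x. indicator \<Omega> x *\<^sub>R (cmod (f x))\<^sup>2)"
    using f by (rule integrable_restrict_space[OF S, THEN iffD1])
  have "AE x in lborel. indicator \<Omega> x *\<^sub>R (cmod (f x))\<^sup>2 = (cmod (F x))\<^sup>2"
    using F(2) by eventually_elim (use F(3) in \<open>auto simp: indicator_def\<close>)
  then have "AE x in lebesgue. indicator \<Omega> x *\<^sub>R (cmod (f x))\<^sup>2 = (cmod (F x))\<^sup>2"
    by (rule AE_completion)
  then have "integrable lebesgue (\<lambda>x. (cmod (F x))\<^sup>2)"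
    using measurable_completion[OF Fm] by (intro integrable_cong_AE_imp[OF i]) auto
  then show ?thesis by (rule integrable_completion[OF Fm, THEN iffD1])
qed

text \<open>\<open>f\<close> is kept unscaled, so the form identity and its Sobolev membership apply
  to it directly; the L^2 arguments use \<open>F\<close>, a Borel version of \<open>f\<close>
  divided by its norm. The number \<open>c\<close> links the two.\<close>

lemma eigenfunction_representative:
  fixes \<Omega> :: "'a::euclidean_space set"
  assumes \<Omega>: "\<Omega> \<in> sets borel" and \<mu>: "is_eigenvalue s \<Omega> A \<mu>"
  obtains f F c where "f \<in> sobolev_space s \<Omega>"
    "\<And>g. g \<in> sobolev_space s \<Omega> \<Longrightarrow>
      magnetic_form s \<Omega> A f g = \<mu> * (LINT x|lebesgue_on \<Omega>. f x * cnj (g x))"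
    "c > 0" "(LINT x|lebesgue_on \<Omega>. f x * cnj (f x)) = complex_of_real (1 / c\<^sup>2)"
    "F \<in> borel_measurable borel" "AE x in lborel. x \<in> \<Omega> \<longrightarrow> F x = complex_of_real c * f x"
    "\<And>x. x \<notin> \<Omega> \<Longrightarrow> F x = 0"
    "integrable lborel (\<lambda>x. (cmod (F x))\<^sup>2)" "(LINT x|lborel. (cmod (F x))\<^sup>2) = 1"
proof -
  obtain f where f: "f \<in> sobolev_space s \<Omega>" "\<not> (AE x in lebesgue_on \<Omega>. f x = 0)"
    "\<And>g. g \<in> sobolev_space s \<Omega> \<Longrightarrow>
      magnetic_form s \<Omega> A f g = \<mu> * (LINT x|lebesgue_on \<Omega>. f x * cnj (g x))"
    using \<mu> unfolding is_eigenvalue_def by blast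
  have fm: "f \<in> borel_measurable (lebesgue_on \<Omega>)" and f2: "integrable (lebesgue_on \<Omega>) (\<lambda>x. (cmod (f x))\<^sup>2)"
    using f(1) by (auto simp: sobolev_space_def)
  obtain G where G: "G \<in> borel_measurable borel" "AE x in lborel. x \<in> \<Omega> \<longrightarrow> G x = f x"
    "\<And>x. x \<notin> \<Omega> \<Longrightarrow> G x = 0"
    using borel_representative[OF fm \<Omega>] by blast
  have G2: "integrable lborel (\<lambda>x. (cmod (G x))\<^sup>2)"
    by (rule integrable_representative[OF \<Omega> G f2])
  define J where "J = (LINT x|lborel. (cmod (G x))\<^sup>2)"
  have "J \<noteq> 0"
  proof
    assume "J = 0"
    then have "AE x in lborel. G x = 0"
      using integral_nonneg_eq_0_iff_AE[OF G2] by (simp add: J_def)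
    then have "AE x in lborel. x \<in> \<Omega> \<longrightarrow> f x = 0" using G(2) by eventually_elim auto
    then have "AE x in lebesgue. x \<in> \<Omega> \<longrightarrow> f x = 0" by (rule AE_completion)
    then have "AE x in lebesgue_on \<Omega>. f x = 0"
      using \<Omega> by (subst AE_restrict_space_iff) auto
    then show False using f(2) by blast
  qed
  moreover have "J \<ge> 0" by (simp add: J_def)
  ultimately have J: "J > 0" by simp
  define c where "c = 1 / sqrt J"
  define F where "F x = complex_of_real c * G x" for x
  have c: "c > 0" "c\<^sup>2 = 1 / J" using J by (auto simp: c_def power_divide)
  have F2: "(cmod (F x))\<^sup>2 = c\<^sup>2 * (cmod (G x))\<^sup>2" for x
    by (simp add: F_def norm_mult power_mult_distrib)
  have "(LINT x|lebesgue_on \<Omega>. f x * cnj (f x)) = (LINT x|lborel. G x * cnj (G x))"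
    by (rule integral_lebesgue_on_representative[OF \<Omega> G G(1,2) fm fm])
  also have "\<dots> = complex_of_real (1 / c\<^sup>2)"
    using c by (simp only: complex_norm_square[symmetric] integral_complex_of_real) (simp add: J_def)
  finally have n: "(LINT x|lebesgue_on \<Omega>. f x * cnj (f x)) = complex_of_real (1 / c\<^sup>2)" .
  have m: "F \<in> borel_measurable borel" unfolding F_def using G(1) by measurable
  have ae: "AE x in lborel. x \<in> \<Omega> \<longrightarrow> F x = complex_of_real c * f x"
    using G(2) by eventually_elim (auto simp: F_def)
  have z: "F x = 0" if "x \<notin> \<Omega>" for x using G(3)[OF that] by (simp add: F_def)
  have i: "integrable lborel (\<lambda>x. (cmod (F x))\<^sup>2)" unfolding F2 using G2 by simp
  have l: "(LINT x|lborel. (cmod (F x))\<^sup>2) = 1" unfolding F2 using c J by (simp add: J_def[symmetric])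
  show ?thesis by (rule that[OF f(1) f(3) c(1) n m ae z i l])
qed

lemma magnetic_diff_scale: "magnetic_diff A (\<lambda>x. c * f x) x y = c * magnetic_diff A f x y"
  by (simp add: magnetic_diff_def algebra_simps)

text \<open>By Hermitian symmetry the form at \<open>f\<close> and \<open>g\<close> equals both
  \<open>\<mu>\<close> and \<open>cnj \<nu>\<close> times the same inner product, and
  \<open>cnj \<nu> = \<nu>\<close>.\<close>

lemma eigenfunctions_orthogonal:
  assumes "magnetic_form s \<Omega> A f g = \<mu> * (LINT x|lebesgue_on \<Omega>. f x * cnj (g x))"
    and "magnetic_form s \<Omega> A g f = \<nu> * (LINT x|lebesgue_on \<Omega>. g x * cnj (f x))"
    and "Im \<nu> = 0" and "\<mu> \<noteq> \<nu>"
  shows "(LINT x|lebesgue_on \<Omega>. f x * cnj (g x)) = 0"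
proof -
  have *: "(LINT x|lebesgue_on \<Omega>. f x * cnj (g x)) = cnj (LINT x|lebesgue_on \<Omega>. g x * cnj (f x))"
    unfolding Bochner_Integration.integral_cnj[symmetric] by (simp add: mult.commute)
  have "cnj \<nu> = \<nu>" using assms(3) by (simp add: complex_eq_iff)
  then have "magnetic_form s \<Omega> A f g = \<nu> * (LINT x|lebesgue_on \<Omega>. f x * cnj (g x))"
    unfolding magnetic_form_commute[of s \<Omega> A f g] assms(2) * by simp
  then show ?thesis using assms(1,4) by (metis mult_right_cancel)
qed

section \<open>Choice of the radius and finiteness\<close>

text \<open>After division by \<open>r ^ N\<close> the left side tends to 0 with \<open>r\<close>,
  because \<open>s > 0\<close>, while the right side is the positive constant
  \<open>\<kappa> ^ N * \<omega>\<close>. The factor 4 ensures that in the counting bound the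
  oscillation term takes up at most half of the left side.\<close>

lemma small_radius:
  fixes s \<rho> \<kappa> \<omega> C E :: real
  assumes "0 < s" "0 < \<rho>" "0 < \<kappa>" "0 < \<omega>"
  obtains r where "0 < r" "r \<le> \<rho>"
    "4 * (2 * r powr (real N + 2 * s) * E + 2 * C\<^sup>2 * r\<^sup>2 * (r ^ N * \<omega>)) \<le> (\<kappa> * r) ^ N * \<omega>"
proof -
  have "((\<lambda>r. r powr (2 * s)) \<longlongrightarrow> 0) (at_right 0)"
    using assms(1) by (intro tendsto_zero_powrI[where b = "2 * s"] tendsto_intros) (auto simp: eventually_at_filter)
  then have "((\<lambda>r. 4 * (2 * r powr (2 * s) * E + 2 * C\<^sup>2 * r\<^sup>2 * \<omega>)) \<longlongrightarrow> 4 * (2 * 0 * E + 2 * C\<^sup>2 * 0\<^sup>2 * \<omega>)) (at_right 0)"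
    by (intro tendsto_intros)
  moreover have "4 * (2 * 0 * E + 2 * C\<^sup>2 * 0\<^sup>2 * \<omega>) < \<kappa> ^ N * \<omega>" using assms by simp
  ultimately have "\<forall>\<^sub>F r in at_right 0. 4 * (2 * r powr (2 * s) * E + 2 * C\<^sup>2 * r\<^sup>2 * \<omega>) < \<kappa> ^ N * \<omega>"
    by (rule order_tendstoD(2))
  moreover have "\<forall>\<^sub>F r in at_right 0. 0 < r \<and> r < \<rho>"
    using assms(2) eventually_at_right_real[of 0 \<rho>] by (auto elim: eventually_mono)
  ultimately have "\<forall>\<^sub>F r in at_right 0. 4 * (2 * r powr (2 * s) * E + 2 * C\<^sup>2 * r\<^sup>2 * \<omega>) < \<kappa> ^ N * \<omega> \<and> 0 < r \<and> r < \<rho>"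
    by eventually_elim auto
  then obtain r where r: "4 * (2 * r powr (2 * s) * E + 2 * C\<^sup>2 * r\<^sup>2 * \<omega>) < \<kappa> ^ N * \<omega>" "0 < r" "r < \<rho>"
    using eventually_happens'[OF trivial_limit_at_right_real] by blast
  have "r powr (real N + 2 * s) = r ^ N * r powr (2 * s)"
    using r by (simp add: powr_add powr_realpow)
  then have "4 * (2 * r powr (real N + 2 * s) * E + 2 * C\<^sup>2 * r\<^sup>2 * (r ^ N * \<omega>))
      = r ^ N * (4 * (2 * r powr (2 * s) * E + 2 * C\<^sup>2 * r\<^sup>2 * \<omega>))"
    by (simp add: algebra_simps)
  also have "\<dots> \<le> r ^ N * (\<kappa> ^ N * \<omega>)" using r by (intro mult_left_mono) auto
  finally show ?thesis using r by (intro that[of r]) (auto simp: power_mult_distrib mult_ac)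
qed

text \<open>One normalised eigenfunction per nonzero eigenvalue gives an orthonormal family indexed
  by the eigenvalues themselves, so the bound on orthonormal families counts distinct
  eigenvalues.\<close>

lemma eigenvalues_finite:
  fixes \<Omega> :: "'a::euclidean_space set"
  assumes \<Omega>: "open \<Omega>" "bounded \<Omega>" "lipschitz_boundary \<Omega>" and s: "0 < s"
    and A: "bounded (A ` (convex hull \<Omega>))"
  shows "finite {\<mu>. is_eigenvalue s \<Omega> A \<mu> \<and> Re \<mu> < E}"
proof -
  \<comment> \<open>The eigenvalue 0 is set aside, since integrability of the form integrand is
    derived from a nonzero value of the form. A single number does not affect finiteness.\<close>
  define M where "M = {\<mu>. is_eigenvalue s \<Omega> A \<mu> \<and> Re \<mu> < E \<and> \<mu> \<noteq> 0}"
  define \<omega> where "\<omega> = measure lborel (ball (0::'a) 1)"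
  have \<omega>: "\<omega> > 0" by (simp add: \<omega>_def content_ball_pos)
  have ball: "measure lborel (ball x t) = t ^ DIM('a) * \<omega>" if "0 \<le> t" for x :: 'a and t
    using content_ball_conv_unit_ball[OF that, of x] by (simp add: \<omega>_def)
  have \<Omega>b: "\<Omega> \<in> sets borel" using \<Omega>(1) by simp
  obtain C where C: "\<And>x. x \<in> convex hull \<Omega> \<Longrightarrow> norm (A x) \<le> C"
    using A unfolding bounded_iff by blast
  obtain \<kappa> \<rho> where \<kappa>: "0 < \<kappa>" "0 < \<rho>"
    "\<And>x t. x \<in> \<Omega> \<Longrightarrow> 0 < t \<Longrightarrow> t \<le> \<rho> \<Longrightarrow> \<exists>c. ball c (\<kappa> * t) \<subseteq> \<Omega> \<inter> ball x t"
    using interior_ball_condition[OF \<Omega>] by metis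
  \<comment> \<open>\<open>\<bar>E\<bar>\<close> replaces \<open>E\<close> so that the bound is
    nonnegative whatever the sign of \<open>E\<close>.\<close>
  obtain r where r: "0 < r" "r \<le> \<rho>" and small:
    "4 * (2 * r powr (real DIM('a) + 2 * s) * \<bar>E\<bar> + 2 * C\<^sup>2 * r\<^sup>2 * (r ^ DIM('a) * \<omega>)) \<le> (\<kappa> * r) ^ DIM('a) * \<omega>"
    using small_radius[OF s \<kappa>(2,1) \<omega>] by blast
  \<comment> \<open>\<open>v\<close> is the volume of an interior ball of radius
    \<open>\<kappa> * r\<close>, and \<open>\<eta>\<close> is the oscillation bound with the form at
    a normalised eigenfunction estimated by \<open>\<bar>E\<bar>\<close>.\<close>
  define v where "v = (\<kappa> * r) ^ DIM('a) * \<omega>"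
  define \<eta> where "\<eta> = 2 * r powr (real DIM('a) + 2 * s) * \<bar>E\<bar> + 2 * C\<^sup>2 * r\<^sup>2 * (r ^ DIM('a) * \<omega>)"
  have v: "0 < v" using \<kappa> r \<omega> by (simp add: v_def)
  have \<eta>: "0 \<le> \<eta>" "4 * \<eta> \<le> v" using small \<omega> r by (auto simp: \<eta>_def v_def)
  have dens: "v \<le> measure lborel (\<Omega> \<inter> ball x r)" if x: "x \<in> \<Omega>" for x
  proof -
    obtain c where c: "ball c (\<kappa> * r) \<subseteq> \<Omega> \<inter> ball x r" using \<kappa>(3)[OF x r] by blast
    have "v = measure lborel (ball c (\<kappa> * r))" using \<kappa> r by (subst ball) (auto simp: v_def)
    also have "\<dots> \<le> measure lborel (\<Omega> \<inter> ball x r)"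
    proof (rule measure_mono_fmeasurable[OF c])
      have "emeasure lborel (\<Omega> \<inter> ball x r) < \<infinity>"
        using \<Omega> by (intro emeasure_bounded_finite) (auto simp: bounded_Int)
      then show "\<Omega> \<inter> ball x r \<in> fmeasurable lborel" using \<Omega> by (intro fmeasurableI) auto
    qed simp
    finally show ?thesis .
  qed
  have "\<forall>\<mu>\<in>M. \<exists>f F c. f \<in> sobolev_space s \<Omega> \<and>
    (\<forall>g\<in>sobolev_space s \<Omega>.
      magnetic_form s \<Omega> A f g = \<mu> * (LINT x|lebesgue_on \<Omega>. f x * cnj (g x))) \<and>
    c > 0 \<and> (LINT x|lebesgue_on \<Omega>. f x * cnj (f x)) = complex_of_real (1 / c\<^sup>2) \<and>
    F \<in> borel_measurable borel \<and> (AE x in lborel. x \<in> \<Omega> \<longrightarrow> F x = complex_of_real c * f x) \<and>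
    (\<forall>x. x \<notin> \<Omega> \<longrightarrow> F x = 0) \<and>
    integrable lborel (\<lambda>x. (cmod (F x))\<^sup>2) \<and> (LINT x|lborel. (cmod (F x))\<^sup>2) = 1"
    (is "\<forall>\<mu>\<in>M. ?P \<mu>")
  proof
    fix \<mu> assume "\<mu> \<in> M"
    then have "is_eigenvalue s \<Omega> A \<mu>" by (simp add: M_def)
    from eigenfunction_representative[OF \<Omega>b this] show "?P \<mu>"
      by (smt (verit, best))
  qed
  then obtain f F c where f: "\<And>\<mu>. \<mu> \<in> M \<Longrightarrow> f \<mu> \<in> sobolev_space s \<Omega>"
    and eig: "\<And>\<mu> g. \<mu> \<in> M \<Longrightarrow> g \<in> sobolev_space s \<Omega> \<Longrightarrow>
      magnetic_form s \<Omega> A (f \<mu>) g = \<mu> * (LINT x|lebesgue_on \<Omega>. f \<mu> x * cnj (g x))"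
    and c: "\<And>\<mu>. \<mu> \<in> M \<Longrightarrow> c \<mu> > 0"
    and nf: "\<And>\<mu>. \<mu> \<in> M \<Longrightarrow> (LINT x|lebesgue_on \<Omega>. f \<mu> x * cnj (f \<mu> x)) = complex_of_real (1 / (c \<mu>)\<^sup>2)"
    and F: "\<And>\<mu>. \<mu> \<in> M \<Longrightarrow> F \<mu> \<in> borel_measurable borel"
      "\<And>\<mu>. \<mu> \<in> M \<Longrightarrow> AE x in lborel. x \<in> \<Omega> \<longrightarrow> F \<mu> x = complex_of_real (c \<mu>) * f \<mu> x"
      "\<And>\<mu> x. \<mu> \<in> M \<Longrightarrow> x \<notin> \<Omega> \<Longrightarrow> F \<mu> x = 0"
    and F2: "\<And>\<mu>. \<mu> \<in> M \<Longrightarrow> integrable lborel (\<lambda>x. (cmod (F \<mu> x))\<^sup>2)"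
      "\<And>\<mu>. \<mu> \<in> M \<Longrightarrow> (LINT x|lborel. (cmod (F \<mu> x))\<^sup>2) = 1"
    unfolding bchoice_iff by blast
  have form: "magnetic_form s \<Omega> A (f \<mu>) (f \<mu>) = \<mu> * complex_of_real (1 / (c \<mu>)\<^sup>2)" if "\<mu> \<in> M" for \<mu>
    using eig[OF that f[OF that]] nf[OF that] by simp
  have M0: "\<mu> \<noteq> 0" "0 < 1 / (c \<mu>)\<^sup>2" if "\<mu> \<in> M" for \<mu> using that c[OF that] by (auto simp: M_def)
  have real: "Im \<mu> = 0" if "\<mu> \<in> M" for \<mu>
    by (rule eigenvalue_form(3)[OF M0[OF that] form[OF that]])
  have fm: "f \<mu> \<in> borel_measurable (lebesgue_on \<Omega>)" if "\<mu> \<in> M" for \<mu>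
    using f[OF that] by (simp add: sobolev_space_def)
  have on: "(LINT x|lborel. F \<mu> x * cnj (F \<nu> x)) = of_bool (\<mu> = \<nu>)" if "\<mu> \<in> M" "\<nu> \<in> M" for \<mu> \<nu>
  proof (cases "\<mu> = \<nu>")
    case True
    have "(LINT x|lborel. F \<nu> x * cnj (F \<nu> x)) = 1"
      using F2(2)[OF that(2)] by (simp only: complex_norm_square[symmetric] integral_complex_of_real) simp
    then show ?thesis using True by simp
  next
    case False
    have "(LINT x|lebesgue_on \<Omega>. f \<mu> x * cnj (f \<nu> x)) = 0"
      using that False by (intro eigenfunctions_orthogonal[OF eig eig] f real)
    moreover have "(LINT x|lborel. F \<mu> x * cnj (F \<nu> x))
      = (LINT x|lebesgue_on \<Omega>. (complex_of_real (c \<mu>) * f \<mu> x) * cnj (complex_of_real (c \<nu>) * f \<nu> x))"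
      using that fm F by (intro integral_lebesgue_on_representative[OF \<Omega>b, symmetric]) auto
    moreover have "\<dots> = (LINT x|lebesgue_on \<Omega>. complex_of_real (c \<mu> * c \<nu>) * (f \<mu> x * cnj (f \<nu> x)))"
      by (simp add: mult_ac)
    ultimately show ?thesis using False by simp
  qed
  have osc: "(\<integral>\<^sup>+ z. ennreal ((cmod (F \<mu> (fst z) - F \<mu> (snd z)))\<^sup>2 * indicator (close_pairs \<Omega> r) z) \<partial>lborel)
      \<le> ennreal \<eta>" if "\<mu> \<in> M" for \<mu>
  proof -
    \<comment> \<open>\<open>h\<close> is the normalised eigenfunction as it enters the form.
      Scaling by \<open>c \<mu>\<close> multiplies the integrand by
      \<open>(c \<mu>)\<^sup>2\<close>, which cancels the squared norm
      \<open>1 / (c \<mu>)\<^sup>2\<close> and leaves \<open>Re \<mu>\<close> as the form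
      value.\<close>
    define h where "h x = complex_of_real (c \<mu>) * f \<mu> x" for x
    define H where "H g z = indicator (\<Omega> \<times> \<Omega>) z *
      ((cmod (magnetic_diff A g (fst z) (snd z)))\<^sup>2 / norm (fst z - snd z) powr (real DIM('a) + 2 * s))" for g z
    have Hh: "H h z = (c \<mu>)\<^sup>2 * H (f \<mu>) z" for z
      by (simp add: H_def h_def[abs_def] magnetic_diff_scale norm_mult power_mult_distrib)
    have Hf: "integrable lebesgue (H (f \<mu>))" "(LINT z|lebesgue. H (f \<mu>) z) = Re \<mu> * (1 / (c \<mu>)\<^sup>2)"
      unfolding H_def[abs_def] using eigenvalue_form[OF M0[OF that] form[OF that]] by auto
    have iH: "integrable lebesgue (H h)" unfolding Hh[abs_def] using Hf(1) by simp
    have "(LINT z|lebesgue. H h z) = Re \<mu>" unfolding Hh using Hf(2) c[OF that] by simp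
    also have "\<dots> \<le> \<bar>E\<bar>" using that unfolding M_def by auto
    finally have E: "(LINT z|lebesgue. H h z) \<le> \<bar>E\<bar>" .
    have "AE x in lborel. x \<in> \<Omega> \<longrightarrow> F \<mu> x = h x" unfolding h_def by (rule F(2)[OF that])
    from local_oscillation_bound[OF \<Omega>(1) s r(1) C F(1)[OF that] this F2(1)[OF that] iH[unfolded H_def[abs_def]]]
    have "(\<integral>\<^sup>+ z. ennreal ((cmod (F \<mu> (fst z) - F \<mu> (snd z)))\<^sup>2 * indicator (close_pairs \<Omega> r) z) \<partial>lborel)
      \<le> ennreal (2 * r powr (real DIM('a) + 2 * s) * (LINT z|lebesgue. H h z)
        + 2 * C\<^sup>2 * r\<^sup>2 * measure lborel (ball (0::'a) r) * 1)"
      unfolding F2(2)[OF that] H_def[symmetric] by simp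
    also have "\<dots> \<le> ennreal \<eta>"
      using E r unfolding \<eta>_def by (intro ennreal_leI add_mono mult_left_mono) (auto simp: ball)
    finally show ?thesis .
  qed
  have "finite M"
  proof (rule ccontr)
    assume "infinite M"
    \<comment> \<open>Since \<open>4 * \<eta> \<le> v\<close>, the counting bound gives
      \<open>n * v \<le> 4 * measure lborel \<Omega>\<close>; the summand 1 pushes \<open>n\<close>
      strictly beyond that.\<close>
    define n where "n = nat \<lceil>4 * measure lborel \<Omega> / v\<rceil> + 1"
    obtain K where K: "K \<subseteq> M" "finite K" "card K = n"
      using infinite_arbitrarily_large[OF \<open>infinite M\<close>] by blast
    have "v * card K \<le> 2 * (card K * \<eta>) + 2 * measure lborel \<Omega>"
    proof (rule orthonormal_card_bound[where e = F, OF \<Omega>(1,2) v dens K(2) _ _ _ _ \<eta>(1)])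
      fix \<mu> assume "\<mu> \<in> K"
      then have "\<mu> \<in> M" using K(1) by blast
      then show "F \<mu> \<in> borel_measurable borel" "integrable lborel (\<lambda>x. (cmod (F \<mu> x))\<^sup>2)"
        "\<And>x. x \<notin> \<Omega> \<Longrightarrow> F \<mu> x = 0"
        "(\<integral>\<^sup>+ z. ennreal ((cmod (F \<mu> (fst z) - F \<mu> (snd z)))\<^sup>2 * indicator (close_pairs \<Omega> r) z) \<partial>lborel)
          \<le> ennreal \<eta>"
        using F F2 osc by blast+
    next
      fix \<mu> \<nu> assume "\<mu> \<in> K" "\<nu> \<in> K"
      then show "(LINT x|lborel. F \<mu> x * cnj (F \<nu> x)) = of_bool (\<mu> = \<nu>)"
        using K(1) by (intro on) auto
    qed
    moreover have "card K * (4 * \<eta>) \<le> card K * v" using \<eta>(2) by (intro mult_left_mono) auto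
    ultimately have "n * v \<le> 4 * measure lborel \<Omega>" using K(3) by (simp add: algebra_simps)
    then have "n \<le> 4 * measure lborel \<Omega> / v" using v by (simp add: field_simps)
    then show False unfolding n_def by linarith
  qed
  moreover have "{\<mu>. is_eigenvalue s \<Omega> A \<mu> \<and> Re \<mu> < E} \<subseteq> insert 0 M" by (auto simp: M_def)
  ultimately show ?thesis by (meson finite.insertI finite_subset)
qed

theorem proposition4p2:
  fixes \<Omega> :: "(real ^ 'n) set" and s :: real and A :: "real ^ 'n \<Rightarrow> real ^ 'n"
  assumes "bounded_lipschitz_domain \<Omega>"
    and "0 < s" and "s < 1"
    and "A \<in> borel_measurable (lebesgue_on (convex hull \<Omega>))"
    and "bounded (A ` (convex hull \<Omega>))"
  shows "\<forall>E::real. 0 < E \<longrightarrow> finite {\<mu>::complex. is_eigenvalue s \<Omega> A \<mu> \<and> Re \<mu> < E}"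
  using assms eigenvalues_finite[of \<Omega> s A]
  by (simp add: bounded_lipschitz_domain_def is_domain_def)

end
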